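(* Let $1,2,3$ be regarded as merely distinct symbols (with $=$ meaning identical as symbols), and let $T^A=\{1,2,3\}=\mathcal{A}^A$, $$A^A=\{(1,2),(2,3),(3,1)\},\qquad S^A=\{(1,3,2),(2,1,3),(3,2,1)\},$$ $$D^A=\{(1,3),(1,2),(2,1),(2,3),(3,2),(3,1)\},\qquad N^A=\{1,2,3\}\ \text{(or } N^A=\{1,2\}\text{)}.$$ Then, for either choice of $N^A$, the structure $\mathcal{D}^A=\langle T^A,S^A,A^A,D^A,N^A\rangle$, with domain $T^A\cup\mathcal{A}^A=\{1,2,3\}$, is a model for the scheme $TAS_1$ and for the scheme $TAS_2$. Hence, $TAS_1$ and $TAS_2$ are, relative to models, consistent schemes.
   Context: The schemes are sets of axioms in a first-order language with equality, with unary predicates $T,N$, binary predicates $A,D$ and a ternary predicate $S$. In the structure, $T,S,A,D,N$ are interpreted by the relations $T^A,S^A,A^A,D^A,N^A$ respectively: $A(y,x)$ holds iff $(y,x)\in A^A$, $S(z,x,y)$ holds iff $(z,x,y)\in S^A$, and so on. $T^A$ is the set of theses and $\mathcal{A}^A$ the set of antitheses. All quantifiers range over the domain. $TAS_1$ consists of the axioms: E1: $\exists x[T(x)]$. E2: $\forall x[T(x)\to\exists!\,y[A(y,x)]]$. E3: $\forall x\forall y[A(y,x)\to\exists!\,z[S(z,x,y)]]$. R1: $\forall x\forall y[A(y,x)\to[T(x)\land\neg A(x,y)]]$. R2: $\forall x\forall y\forall z[S(z,x,y)\to[T(z)\land[A(x,y)\lor A(y,x)]\land\neg[S(x,z,y)\lor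 S(y,x,z)]]]$. $TAS_2$ consists of the definition $N(z):=\exists x\exists y[S(z,x,y)\land D(z,x)\land D(z,y)]$ and the axioms E1, E2, E3, R1, R2 together with: E4: $\exists x[N(x)]$. E5: $\forall x[N(x)\to\exists y[N(y)\land y\neq x]]$. The defined predicate $N$ may be taken restricted to various theses (such theses are called nodal points); so $N^A$ may be a set of some of the theses that satisfy the defining condition for $N$, and E4 and E5 are read with $N$ interpreted by $N^A$. *)

theory Defs
  imports Main
begin

section \<open>First-order formulas over the relation symbols T, N, A, D, S\<close>

type_synonym var = string

datatype fm =
    Tp var
  | Np var
  | Ap var var
  | Dp var var
  | Sp var var var
  | Equ var var       (infix "\<^bold>=" 50)
  | Neg fm            ("\<^bold>\<not> _" [40] 40)
  | Conj fm fm        (infixr "\<^bold>\<and>" 35)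
  | Disj fm fm        (infixr "\<^bold>\<or>" 30)
  | Impl fm fm        (infixr "\<^bold>\<longrightarrow>" 25)
  | Iff fm fm         (infixr "\<^bold>\<longleftrightarrow>" 24)
  | Forall var fm     ("(\<^bold>\<forall>_./ _)" [100, 10] 10)
  | Exists var fm     ("(\<^bold>\<exists>_./ _)" [100, 10] 10)

text \<open>\<open>Uniq w v \<phi>\<close> is "there is exactly one \<open>v\<close> such that \<open>\<phi>\<close>", written out with equality.
  The auxiliary variable \<open>w\<close> must differ from \<open>v\<close> and must not occur free in \<open>\<phi>\<close>.\<close>

definition Uniq :: "var \<Rightarrow> var \<Rightarrow> fm \<Rightarrow> fm" where
  "Uniq w v \<phi> = (\<^bold>\<exists>w. \<^bold>\<forall>v. \<phi> \<^bold>\<longleftrightarrow> v \<^bold>= w)"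

section \<open>Structures and models\<close>

record 'a struct =
  Dom  :: "'a set"
  Trel :: "'a set"
  Srel :: "('a \<times> 'a \<times> 'a) set"
  Arel :: "('a \<times> 'a) set"
  Drel :: "('a \<times> 'a) set"
  Nrel :: "'a set"

definition wf_struct :: "'a struct \<Rightarrow> bool" where
  "wf_struct M \<longleftrightarrow> Dom M \<noteq> {} \<and> Trel M \<subseteq> Dom M \<and> Srel M \<subseteq> Dom M \<times> Dom M \<times> Dom M \<and>
     Arel M \<subseteq> Dom M \<times> Dom M \<and> Drel M \<subseteq> Dom M \<times> Dom M \<and> Nrel M \<subseteq> Dom M"

fun sat :: "'a struct \<Rightarrow> (var \<Rightarrow> 'a) \<Rightarrow> fm \<Rightarrow> bool" where
  "sat M e (Tp x) \<longleftrightarrow> e x \<in> Trel M"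
| "sat M e (Np x) \<longleftrightarrow> e x \<in> Nrel M"
| "sat M e (Ap x y) \<longleftrightarrow> (e x, e y) \<in> Arel M"
| "sat M e (Dp x y) \<longleftrightarrow> (e x, e y) \<in> Drel M"
| "sat M e (Sp x y z) \<longleftrightarrow> (e x, e y, e z) \<in> Srel M"
| "sat M e (x \<^bold>= y) \<longleftrightarrow> e x = e y"
| "sat M e (\<^bold>\<not> \<phi>) \<longleftrightarrow> \<not> sat M e \<phi>"
| "sat M e (\<phi> \<^bold>\<and> \<psi>) \<longleftrightarrow> sat M e \<phi> \<and> sat M e \<psi>"
| "sat M e (\<phi> \<^bold>\<or> \<psi>) \<longleftrightarrow> sat M e \<phi> \<or> sat M e \<psi>"
| "sat M e (\<phi> \<^bold>\<longrightarrow> \<psi>) \<longleftrightarrow> (sat M e \<phi> \<longrightarrow> sat M e \<psi>)"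
| "sat M e (\<phi> \<^bold>\<longleftrightarrow> \<psi>) \<longleftrightarrow> (sat M e \<phi> \<longleftrightarrow> sat M e \<psi>)"
| "sat M e (\<^bold>\<forall>x. \<phi>) \<longleftrightarrow> (\<forall>d \<in> Dom M. sat M (e(x := d)) \<phi>)"
| "sat M e (\<^bold>\<exists>x. \<phi>) \<longleftrightarrow> (\<exists>d \<in> Dom M. sat M (e(x := d)) \<phi>)"

definition model :: "'a struct \<Rightarrow> fm set \<Rightarrow> bool" where
  "model M \<Gamma> \<longleftrightarrow> wf_struct M \<and> (\<forall>\<phi> \<in> \<Gamma>. \<forall>e. range e \<subseteq> Dom M \<longrightarrow> sat M e \<phi>)"

text \<open>Consistency relative to models: the scheme has a model. HOL cannot quantify over types
  inside a formula, so the type of the elements of the model is an explicit argument.\<close>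

definition consistent_rel_models :: "'a itself \<Rightarrow> fm set \<Rightarrow> bool" where
  "consistent_rel_models _ \<Gamma> \<longleftrightarrow> (\<exists>M :: 'a struct. model M \<Gamma>)"

section \<open>The schemes\<close>

abbreviation (input) vx :: var where "vx \<equiv> ''x''"
abbreviation (input) vy :: var where "vy \<equiv> ''y''"
abbreviation (input) vz :: var where "vz \<equiv> ''z''"
abbreviation (input) vw :: var where "vw \<equiv> ''w''"

definition E1 :: fm where
  "E1 = (\<^bold>\<exists>vx. Tp vx)"

definition E2 :: fm where
  "E2 = (\<^bold>\<forall>vx. Tp vx \<^bold>\<longrightarrow> Uniq vw vy (Ap vy vx))"

definition E3 :: fm where
  "E3 = (\<^bold>\<forall>vx. \<^bold>\<forall>vy. Ap vy vx \<^bold>\<longrightarrow> Uniq vw vz (Sp vz vx vy))"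

definition R1 :: fm where
  "R1 = (\<^bold>\<forall>vx. \<^bold>\<forall>vy. Ap vy vx \<^bold>\<longrightarrow> (Tp vx \<^bold>\<and> \<^bold>\<not> Ap vx vy))"

definition R2 :: fm where
  "R2 = (\<^bold>\<forall>vx. \<^bold>\<forall>vy. \<^bold>\<forall>vz. Sp vz vx vy \<^bold>\<longrightarrow>
          (Tp vz \<^bold>\<and> (Ap vx vy \<^bold>\<or> Ap vy vx) \<^bold>\<and> \<^bold>\<not> (Sp vx vz vy \<^bold>\<or> Sp vy vx vz)))"

definition E4 :: fm where
  "E4 = (\<^bold>\<exists>vx. Np vx)"

definition E5 :: fm where
  "E5 = (\<^bold>\<forall>vx. Np vx \<^bold>\<longrightarrow> (\<^bold>\<exists>vy. Np vy \<^bold>\<and> \<^bold>\<not> vy \<^bold>= vx))"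

definition nodal :: fm where
  "nodal = (\<^bold>\<exists>vx. \<^bold>\<exists>vy. Sp vz vx vy \<^bold>\<and> Dp vz vx \<^bold>\<and> Dp vz vy)"

text \<open>The definition of N, in two readings. \<open>N_full\<close> is the literal definition. \<open>N_restr\<close> allows
  N to be restricted to some of the theses satisfying the defining condition, as in the
  interpretation of N by \<open>{1, 2}\<close>, which falsifies \<open>N_full\<close>.\<close>

definition N_full :: fm where
  "N_full = (\<^bold>\<forall>vz. Np vz \<^bold>\<longleftrightarrow> nodal)"

definition N_restr :: fm where
  "N_restr = (\<^bold>\<forall>vz. Np vz \<^bold>\<longrightarrow> (Tp vz \<^bold>\<and> nodal))"

definition TAS1 :: "fm set" where
  "TAS1 = {E1, E2, E3, R1, R2}"

definition TAS2 :: "fm set" where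
  "TAS2 = {N_restr, E1, E2, E3, R1, R2, E4, E5}"

definition TAS2_full :: "fm set" where
  "TAS2_full = {N_full, E1, E2, E3, R1, R2, E4, E5}"

section \<open>The three-element structure\<close>

datatype sym = One ("\<^bold>1") | Two ("\<^bold>2") | Three ("\<^bold>3")

definition T_A :: "sym set" where
  "T_A = {\<^bold>1, \<^bold>2, \<^bold>3}"

definition Anti_A :: "sym set" where
  "Anti_A = {\<^bold>1, \<^bold>2, \<^bold>3}"

definition A_A :: "(sym \<times> sym) set" where
  "A_A = {(\<^bold>1, \<^bold>2), (\<^bold>2, \<^bold>3), (\<^bold>3, \<^bold>1)}"

definition S_A :: "(sym \<times> sym \<times> sym) set" where
  "S_A = {(\<^bold>1, \<^bold>3, \<^bold>2), (\<^bold>2, \<^bold>1, \<^bold>3), (\<^bold>3, \<^bold>2, \<^bold>1)}"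

definition D_A :: "(sym \<times> sym) set" where
  "D_A = {(\<^bold>1, \<^bold>3), (\<^bold>1, \<^bold>2), (\<^bold>2, \<^bold>1), (\<^bold>2, \<^bold>3), (\<^bold>3, \<^bold>2), (\<^bold>3, \<^bold>1)}"

definition struct_D :: "sym set \<Rightarrow> sym struct" where
  "struct_D N = \<lparr>Dom = T_A \<union> Anti_A, Trel = T_A, Srel = S_A, Arel = A_A, Drel = D_A, Nrel = N\<rparr>"

text \<open>\<open>Anti_A\<close> is indeed the set of antitheses: \<open>A(y, x)\<close> says that \<open>y\<close> is an antithesis of \<open>x\<close>.\<close>

lemma Anti_A_eq: "Anti_A = {y. \<exists>x. (y, x) \<in> A_A}"
  by (auto simp: Anti_A_def A_A_def)

end

theory Submission
  imports Defs
begin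

text \<open>Everything rests on cyclic symmetry of order three. \<open>A_A\<close> is a directed
  3-cycle, so antitheses exist uniquely and no pair is mutual (E2, R1). The synthesis of two
  neighbours is the third element, which gives E3. The triples of \<open>S_A\<close> are the
  rotations of one triple, and swapping two entries reverses the orientation, hence R2.
  \<open>D_A\<close> is inequality, so every element is nodal (\<open>sat_nodal_struct_D\<close>);
  this settles both readings of N.\<close>

lemma Dom_struct_D [simp]: "Dom (struct_D N) = {\<^bold>1, \<^bold>2, \<^bold>3}"
  by (simp add: struct_D_def T_A_def Anti_A_def)

lemma struct_D_sel [simp]:
  "Trel (struct_D N) = {\<^bold>1, \<^bold>2, \<^bold>3}"
  "Srel (struct_D N) = S_A" "Arel (struct_D N) = A_A"
  "Drel (struct_D N) = D_A" "Nrel (struct_D N) = N"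
  by (simp_all add: struct_D_def T_A_def)

lemma wf_struct_D: "N \<subseteq> {\<^bold>1, \<^bold>2, \<^bold>3} \<Longrightarrow> wf_struct (struct_D N)"
  by (auto simp: wf_struct_def S_A_def A_A_def D_A_def)

text \<open>N does not occur in \<open>TAS1\<close>; it enters only through well-formedness. The
  rest is a finite check.\<close>

lemma model_TAS1_struct_D:
  assumes "N \<subseteq> {\<^bold>1, \<^bold>2, \<^bold>3}"
  shows "model (struct_D N) TAS1"
  using wf_struct_D[OF assms]
  by (auto simp: model_def TAS1_def E1_def E2_def E3_def R1_def R2_def Uniq_def A_A_def S_A_def)

text \<open>Each element heads a triple of \<open>S_A\<close> whose other two entries differ from
  it, hence are \<open>D_A\<close>-related to it. Only the value of \<open>vz\<close>
  matters.\<close>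

lemma sat_nodal_struct_D:
  assumes "range e \<subseteq> {\<^bold>1, \<^bold>2, \<^bold>3}"
  shows "sat (struct_D N) e nodal"
proof -
  have "e vz \<in> {\<^bold>1, \<^bold>2, \<^bold>3}"
    using assms by blast
  then show ?thesis
    by (auto simp: nodal_def S_A_def D_A_def)
qed

text \<open>As every element is a nodal thesis, any N satisfies the restricted reading, while the
  literal definition forces N to be the whole domain.\<close>

lemma sat_N_struct_D:
  assumes "range e \<subseteq> {\<^bold>1, \<^bold>2, \<^bold>3}"
  shows "sat (struct_D N) e N_restr" "sat (struct_D {\<^bold>1, \<^bold>2, \<^bold>3}) e N_full"
proof -
  \<comment> \<open>General in \<open>M\<close>, since the two claims concern structures with
    different N.\<close>
  have "sat (struct_D M) (e(vz := d)) nodal" if "d \<in> {\<^bold>1, \<^bold>2, \<^bold>3}" for d M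
    using assms that by (intro sat_nodal_struct_D) auto
  then show "sat (struct_D N) e N_restr" "sat (struct_D {\<^bold>1, \<^bold>2, \<^bold>3}) e N_full"
    by (simp_all add: N_restr_def N_full_def)
qed

text \<open>For E5, the second node is 2 if the given one is 1, and 1 otherwise.\<close>

lemma sat_E4_E5_struct_D:
  assumes "N \<subseteq> {\<^bold>1, \<^bold>2, \<^bold>3}" "\<^bold>1 \<in> N" "\<^bold>2 \<in> N"
  shows "sat (struct_D N) e E4" "sat (struct_D N) e E5"
  using assms by (auto simp: E4_def E5_def)

lemma model_TAS2_struct_D:
  assumes "N \<subseteq> {\<^bold>1, \<^bold>2, \<^bold>3}" "\<^bold>1 \<in> N" "\<^bold>2 \<in> N"
  shows "model (struct_D N) TAS2"
  using model_TAS1_struct_D[OF assms(1)] sat_N_struct_D(1) sat_E4_E5_struct_D[OF assms]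
  by (simp add: model_def TAS1_def TAS2_def)

lemma model_TAS2_full_struct_D: "model (struct_D {\<^bold>1, \<^bold>2, \<^bold>3}) TAS2_full"
  using model_TAS1_struct_D[of "{\<^bold>1, \<^bold>2, \<^bold>3}"] sat_N_struct_D(2)
    sat_E4_E5_struct_D[of "{\<^bold>1, \<^bold>2, \<^bold>3}"]
  by (simp add: model_def TAS1_def TAS2_full_def)

theorem theorem2p2:
  shows "(\<forall>N_A \<in> {{\<^bold>1, \<^bold>2, \<^bold>3}, {\<^bold>1, \<^bold>2}}.
            Dom (struct_D N_A) = {\<^bold>1, \<^bold>2, \<^bold>3} \<and>
            model (struct_D N_A) TAS1 \<and>
            model (struct_D N_A) TAS2)
       \<and> model (struct_D {\<^bold>1, \<^bold>2, \<^bold>3}) TAS2_full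
       \<and> consistent_rel_models TYPE(sym) TAS1
       \<and> consistent_rel_models TYPE(sym) TAS2
       \<and> consistent_rel_models TYPE(sym) TAS2_full"
proof -
  have *: "model (struct_D N) TAS1 \<and> model (struct_D N) TAS2"
    if "N \<in> {{\<^bold>1, \<^bold>2, \<^bold>3}, {\<^bold>1, \<^bold>2}}" for N
    using that by (auto intro: model_TAS1_struct_D model_TAS2_struct_D)
  then show ?thesis
    \<comment> \<open>The explicit instance supplies the witness for consistency of
      \<open>TAS1\<close> and \<open>TAS2\<close>.\<close>
    using model_TAS2_full_struct_D *[of "{\<^bold>1, \<^bold>2}"]
    unfolding consistent_rel_models_def by auto
qed

end
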